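(* The simple random walk on $\Gamma\cong\mathbb{Z}[\frac12]$, i.e. the Markov chain on $\mathbb{Z}[\frac12]$ which from a point $\gamma$ moves to each of $\widetilde A(\gamma)$, $\widetilde A^{-1}(\gamma)$, $\widetilde B(\gamma)$, $\widetilde B^{-1}(\gamma)$ with probability $\frac14$ (coinciding targets have their probabilities added), is transient.
   Context: $\widetilde A,\widetilde B:\mathbb{R}\to\mathbb{R}$ are the piecewise linear homeomorphisms $\widetilde A(\gamma)=\gamma-1$ and $\widetilde B(\gamma)=\gamma$ for $\gamma\le 0$, $\widetilde B(\gamma)=\gamma/2$ for $0\le\gamma\le 2$, $\widetilde B(\gamma)=\gamma-1$ for $\gamma\ge 2$. They generate a group $\widetilde F$ isomorphic to Thompson's group $F$, and both they and their inverses preserve the set $\mathbb{Z}[\frac12]$ of dyadic rational numbers, on which $\widetilde F$ acts transitively. $\Gamma$ denotes the Schreier graph of the action of $\widetilde F$ on $\mathbb{Z}[\frac12]$ with respect to the generating set $K=\{\widetilde A,\widetilde B,\widetilde A^{-1},\widetilde B^{-1}\}$: its vertex set is $\mathbb{Z}[\frac12]$, and each $\gamma$ is joined to $g(\gamma)$, $g\in K$. Transient means that almost every sample path goes to infinity (leaves every finite subset of the state space forever); equivalently, the expected number of visits to any state is finite. *)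

theory Defs
  imports "HOL-Probability.Probability" "Graph_Theory.Digraph"
begin

definition A_tilde :: "real \<Rightarrow> real" where
  "A_tilde \<gamma> = \<gamma> - 1"

definition B_tilde :: "real \<Rightarrow> real" where
  "B_tilde \<gamma> = (if \<gamma> \<le> 0 then \<gamma> else if \<gamma> \<le> 2 then \<gamma> / 2 else \<gamma> - 1)"

definition gens :: "(real \<Rightarrow> real) set" where
  "gens = {A_tilde, B_tilde, inv A_tilde, inv B_tilde}"

definition dyadic_rationals :: "real set" where
  "dyadic_rationals = {of_int m / 2 ^ n | (m::int) (n::nat). True}"

text \<open>Every vertex \<open>v\<close> has one outgoing arc \<open>(v, g)\<close> per generator, so loops and parallel arcs
  are kept. The set \<open>gens\<close> is closed under inversion, hence \<open>(v, g)\<close> and \<open>(g v, inv g)\<close>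
  together represent one undirected edge.\<close>

definition schreier_graph :: "('s \<Rightarrow> 's) set \<Rightarrow> 's set \<Rightarrow> ('s, 's \<times> ('s \<Rightarrow> 's)) pre_digraph" where
  "schreier_graph K V = \<lparr>verts = V, arcs = V \<times> K, tail = fst, head = (\<lambda>(v, g). g v)\<rparr>"

definition \<Gamma> :: "(real, real \<times> (real \<Rightarrow> real)) pre_digraph" where
  "\<Gamma> = schreier_graph gens dyadic_rationals"

definition srw_step :: "('s, 'e) pre_digraph \<Rightarrow> 's \<Rightarrow> 's pmf" where
  "srw_step G v = map_pmf (head G) (pmf_of_set (out_arcs G v))"

text \<open>Time-homogeneous Markov chains on a countable state space \<open>S\<close> with transition
  probabilities \<open>P\<close>; the initial distribution is arbitrary.\<close>

definition markov_chain :: "'s set \<Rightarrow> ('s \<Rightarrow> 's pmf) \<Rightarrow> 'w measure \<Rightarrow> (nat \<Rightarrow> 'w \<Rightarrow> 's) \<Rightarrow> bool" where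
  "markov_chain S P M X \<longleftrightarrow>
     prob_space M \<and>
     (\<forall>n. X n \<in> measurable M (count_space S)) \<and>
     (\<forall>n x. \<forall>y\<in>S. \<P>(\<omega> in M. \<forall>i\<le>n. X i \<omega> = x i) \<noteq> 0 \<longrightarrow>
        \<P>(\<omega> in M. X (Suc n) \<omega> = y \<bar> \<forall>i\<le>n. X i \<omega> = x i) = pmf (P (x n)) y)"

definition simple_random_walk :: "('s, 'e) pre_digraph \<Rightarrow> 'w measure \<Rightarrow> (nat \<Rightarrow> 'w \<Rightarrow> 's) \<Rightarrow> bool" where
  "simple_random_walk G M X \<longleftrightarrow> markov_chain (verts G) (srw_step G) M X"

definition transient :: "'s set \<Rightarrow> 'w measure \<Rightarrow> (nat \<Rightarrow> 'w \<Rightarrow> 's) \<Rightarrow> bool" where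
  "transient S M X \<longleftrightarrow>
     (AE \<omega> in M. \<forall>T. finite T \<longrightarrow> T \<subseteq> S \<longrightarrow> (\<exists>N. \<forall>n\<ge>N. X n \<omega> \<notin> T))"

lemma inv_A_tilde: "inv A_tilde \<gamma> = \<gamma> + 1"
  by (rule inv_f_eq) (auto simp: A_tilde_def inj_def)

lemma inv_B_tilde: "inv B_tilde \<gamma> = (if \<gamma> \<le> 0 then \<gamma> else if \<gamma> \<le> 1 then 2 * \<gamma> else \<gamma> + 1)"
  by (rule inv_f_eq) (auto simp: B_tilde_def inj_def split: if_splits)

lemma gens_distinct: "distinct [A_tilde, B_tilde, inv A_tilde, inv B_tilde]"
proof -
  have "A_tilde (-1) = -2" "B_tilde (-1) = -1" "inv A_tilde (-1) = 0" "inv B_tilde (-1) = -1"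
    "B_tilde 1 = 1 / 2" "inv B_tilde 1 = 2"
    by (simp_all add: A_tilde_def B_tilde_def inv_A_tilde inv_B_tilde)
  then show ?thesis
    by (auto dest: fun_cong[where x = "-1"] fun_cong[where x = 1])
qed

lemma srw_step_Gamma:
  assumes "\<gamma> \<in> dyadic_rationals"
  shows "srw_step \<Gamma> \<gamma> = pmf_of_multiset {#A_tilde \<gamma>, inv A_tilde \<gamma>, B_tilde \<gamma>, inv B_tilde \<gamma>#}"
proof (rule pmf_eqI)
  have fin: "finite gens" "gens \<noteq> {}" by (simp_all add: gens_def)
  have oa: "out_arcs \<Gamma> \<gamma> = Pair \<gamma> ` gens"
    using assms by (auto simp: out_arcs_def \<Gamma>_def schreier_graph_def)
  have "pmf_of_set (out_arcs \<Gamma> \<gamma>) = map_pmf (Pair \<gamma>) (pmf_of_set gens)"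
    unfolding oa by (rule map_pmf_of_set_inj[symmetric]) (auto simp: inj_on_def fin)
  then have s: "srw_step \<Gamma> \<gamma> = map_pmf (\<lambda>g. g \<gamma>) (pmf_of_set gens)"
    by (simp add: srw_step_def map_pmf_comp \<Gamma>_def schreier_graph_def)
  fix y
  have "pmf (srw_step \<Gamma> \<gamma>) y = (\<Sum>g\<in>gens. (if g \<gamma> = y then 1 else 0) / 4)"
    unfolding s pmf_map measure_pmf_of_set[OF fin(2,1)]
    using gens_distinct fin
    by (auto simp: gens_def sum.If_cases Int_def vimage_def simp flip: sum_divide_distrib)
  then show "pmf (srw_step \<Gamma> \<gamma>) y =
      pmf (pmf_of_multiset {#A_tilde \<gamma>, inv A_tilde \<gamma>, B_tilde \<gamma>, inv B_tilde \<gamma>#}) y"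
    using gens_distinct by (auto simp: gens_def)
qed

lemma wf_Gamma: "wf_digraph \<Gamma>"
proof
  fix e assume e: "e \<in> arcs \<Gamma>"
  show "tail \<Gamma> e \<in> verts \<Gamma>" using e by (auto simp: \<Gamma>_def schreier_graph_def)
  have Z: "of_int m / 2 ^ n \<in> dyadic_rationals" for m n by (auto simp: dyadic_rationals_def)
  have "g \<gamma> \<in> dyadic_rationals" if a: "\<gamma> \<in> dyadic_rationals" "g \<in> gens" for g \<gamma>
  proof -
    obtain m n where g: "\<gamma> = of_int m / 2 ^ n" using a(1) by (auto simp: dyadic_rationals_def)
    have "\<gamma> - 1 = of_int (m - 2^n) / 2 ^ n" "\<gamma> + 1 = of_int (m + 2^n) / 2 ^ n"
      "\<gamma> / 2 = of_int m / 2 ^ Suc n" "2 * \<gamma> = of_int (2 * m) / 2 ^ n"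
      by (simp_all add: g field_simps)
    then have "\<gamma> - 1 \<in> dyadic_rationals" "\<gamma> + 1 \<in> dyadic_rationals" "\<gamma> / 2 \<in> dyadic_rationals" "2 * \<gamma> \<in> dyadic_rationals"
      using Z by metis+
    then show ?thesis using a
      by (auto simp: gens_def A_tilde_def B_tilde_def inv_A_tilde inv_B_tilde)
  qed
  then show "head \<Gamma> e \<in> verts \<Gamma>" using e by (auto simp: \<Gamma>_def schreier_graph_def)
qed

end

theory Submission imports Defs begin

text \<open>A bounded function \<open>f \<ge> 0\<close> that is superharmonic, and strictly so at a state \<open>z\<close>,
  bounds the expected number of visits to \<open>z\<close>: the expectation of \<open>f (X n)\<close> drops by at least
  \<open>\<epsilon> P(X n = z)\<close> in each step. On \<open>\<Gamma>\<close> such a function is explicit, decaying geometrically in the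
  exponent of the denominator, with \<open>z = 1\<close>. Finiteness passes from a state to its predecessors, and
  \<open>1\<close> can be reached from every dyadic rational, so Borel-Cantelli applies to every state.\<close>

section \<open>Visits of Markov chains on a countable state space\<close>

lemma markov_chain_in_states:
  assumes "markov_chain S P M X" "\<omega> \<in> space M"
  shows "X n \<omega> \<in> S"
  using assms measurable_space[of "X n" M "count_space S" \<omega>] by (simp add: markov_chain_def)

lemma sets_markov_chain_visit:
  assumes mc: "markov_chain S P M X"
  shows "{\<omega> \<in> space M. X n \<omega> = x} \<in> sets M"
proof -
  have "{\<omega> \<in> space M. X n \<omega> = x} = X n -` ({x} \<inter> S) \<inter> space M"
    using markov_chain_in_states[OF mc] by auto
  then show ?thesis
    using mc measurable_sets[of "X n" M "count_space S" "{x} \<inter> S"] by (simp add: markov_chain_def)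
qed

text \<open>\<open>markov_chain\<close> conditions on the whole history, not only on the current
  state. The event \<open>X n = x\<close> is therefore split into the countably many histories that
  end in \<open>x\<close>. Each of them contributes the same factor
  \<open>pmf (P x) y\<close>.\<close>

lemma markov_chain_joint_prob:
  assumes mc: "markov_chain S P M X" and S: "countable S" and xy: "x \<in> S" "y \<in> S"
  shows "emeasure M {\<omega> \<in> space M. X n \<omega> = x \<and> X (Suc n) \<omega> = y}
    = emeasure M {\<omega> \<in> space M. X n \<omega> = x} * ennreal (pmf (P x) y)"
proof -
  interpret prob_space M using mc by (simp add: markov_chain_def)
  note XS = markov_chain_in_states[OF mc]
  note single[measurable] = sets_markov_chain_visit[OF mc]
  define H where "H l = {\<omega> \<in> space M. \<forall>i\<le>n. X i \<omega> = l ! i}" for l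
  \<comment> \<open>Coding histories as lists makes countability immediate: lists over a countable
    set are countable.\<close>
  define I where "I = {l \<in> lists S. length l = Suc n \<and> l ! n = x}"
  have I: "countable I" unfolding I_def
    by (rule countable_subset[OF _ countable_lists[OF S]]) auto
  have Hm[measurable]: "H l \<in> sets M" for l
  proof -
    have "H l = (\<Inter>i\<in>{..n}. {\<omega> \<in> space M. X i \<omega> = l ! i})" by (auto simp: H_def)
    then show ?thesis by (simp add: sets.finite_INT single)
  qed
  define Y where "Y = {\<omega> \<in> space M. X (Suc n) \<omega> = y}"
  have Y[measurable]: "Y \<in> sets M" unfolding Y_def by (rule single)
  have disj: "disjoint_family_on H I"
    unfolding disjoint_family_on_def
  proof (intro ballI impI)
    fix l m assume lm: "l \<in> I" "m \<in> I" "l \<noteq> m"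
    then obtain i where "i \<le> n" "l ! i \<noteq> m ! i"
      by (auto simp: I_def list_eq_iff_nth_eq less_Suc_eq_le)
    then show "H l \<inter> H m = {}" unfolding H_def by force
  qed
  have un: "{\<omega> \<in> space M. X n \<omega> = x} = (\<Union>l\<in>I. H l)"
  proof (intro equalityI subsetI)
    fix \<omega> assume \<omega>: "\<omega> \<in> {\<omega> \<in> space M. X n \<omega> = x}"
    have "map (\<lambda>i. X i \<omega>) [0..<Suc n] \<in> I"
      using \<omega> XS by (auto simp: I_def simp del: upt_Suc)
    moreover have "\<omega> \<in> H (map (\<lambda>i. X i \<omega>) [0..<Suc n])"
      using \<omega> by (auto simp: H_def simp del: upt_Suc)
    ultimately show "\<omega> \<in> (\<Union>l\<in>I. H l)" by blast
  qed (auto simp: H_def I_def)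
  have step: "emeasure M (H l \<inter> Y) = emeasure M (H l) * ennreal (pmf (P x) y)" if "l \<in> I" for l
  proof (cases "prob (H l) = 0")
    \<comment> \<open>The Markov property says nothing about null histories; here both sides
      vanish.\<close>
    case True
    then show ?thesis
      using finite_measure_mono[of "H l \<inter> Y" "H l"] measure_nonneg[of M "H l \<inter> Y"]
      by (simp add: emeasure_eq_measure del: measure_nonneg)
  next
    case False
    have "\<P>(\<omega> in M. X (Suc n) \<omega> = y \<bar> \<forall>i\<le>n. X i \<omega> = l ! i) = pmf (P (l ! n)) y"
      using mc xy(2) False unfolding markov_chain_def H_def by (auto dest: spec[where x = "(!) l"])
    moreover have "{\<omega> \<in> space M. X (Suc n) \<omega> = y \<and> (\<forall>i\<le>n. X i \<omega> = l ! i)} = H l \<inter> Y"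
      by (auto simp: H_def Y_def)
    ultimately have "prob (H l \<inter> Y) = prob (H l) * pmf (P x) y"
      using False that by (simp add: cond_prob_def H_def[symmetric] I_def field_simps)
    then show ?thesis by (simp add: emeasure_eq_measure ennreal_mult)
  qed
  have "{\<omega> \<in> space M. X n \<omega> = x \<and> X (Suc n) \<omega> = y} = (\<Union>l\<in>I. H l \<inter> Y)"
    using un by (auto simp: Y_def)
  also have "emeasure M \<dots> = (\<integral>\<^sup>+l. emeasure M (H l \<inter> Y) \<partial>count_space I)"
    using disj by (intro emeasure_UN_countable I) (auto simp: disjoint_family_on_def)
  also have "\<dots> = (\<integral>\<^sup>+l. emeasure M (H l) * ennreal (pmf (P x) y) \<partial>count_space I)"
    by (intro nn_integral_cong) (simp add: step)
  also have "\<dots> = emeasure M {\<omega> \<in> space M. X n \<omega> = x} * ennreal (pmf (P x) y)"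
    unfolding un by (simp add: nn_integral_multc emeasure_UN_countable[OF _ I disj])
  finally show ?thesis .
qed

text \<open>With the law of \<open>X n\<close> as a pmf, one step of the chain becomes
  \<open>bind_pmf\<close>. Inside \<open>S\<close> the last claim follows by summing the joint
  probabilities over \<open>x\<close>. Outside \<open>S\<close> its left side is 0, so the
  inequality holds without assuming that \<open>P\<close> stays in \<open>S\<close>.\<close>

lemma markov_chain_laws:
  assumes mc: "markov_chain S P M X" and S: "countable S"
  obtains \<mu> :: "nat \<Rightarrow> 's pmf" where
    "\<And>n x. ennreal (pmf (\<mu> n) x) = emeasure M {\<omega> \<in> space M. X n \<omega> = x}"
    "\<And>n. set_pmf (\<mu> n) \<subseteq> S"
    "\<And>n y. pmf (\<mu> (Suc n)) y \<le> pmf (bind_pmf (\<mu> n) P) y"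
proof -
  interpret prob_space M using mc by (simp add: markov_chain_def)
  note XS = markov_chain_in_states[OF mc]
  note single[measurable] = sets_markov_chain_visit[OF mc]
  have out: "{\<omega> \<in> space M. X i \<omega> = z} = {}" if "z \<notin> S" for i z using XS that by auto
  define p where "p n x = prob {\<omega> \<in> space M. X n \<omega> = x}" for n x
  have p: "ennreal (p n x) = emeasure M {\<omega> \<in> space M. X n \<omega> = x}" for n x
    by (simp add: p_def emeasure_eq_measure)
  have total: "(\<integral>\<^sup>+x. p n x \<partial>count_space UNIV) = 1" for n
  proof -
    have "(\<integral>\<^sup>+x. p n x \<partial>count_space UNIV) = (\<integral>\<^sup>+x. p n x \<partial>count_space S)"
      by (rule nn_integral_count_space_eq) (simp_all add: p_def out)
    also have "\<dots> = emeasure M (\<Union>x\<in>S. {\<omega> \<in> space M. X n \<omega> = x})"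
      unfolding p by (rule emeasure_UN_countable[symmetric]) (auto simp: S disjoint_family_on_def)
    also have "(\<Union>x\<in>S. {\<omega> \<in> space M. X n \<omega> = x}) = space M" using XS by auto
    finally show ?thesis by (simp add: emeasure_space_1)
  qed
  define \<mu> where "\<mu> n = embed_pmf (p n)" for n
  have \<mu>: "pmf (\<mu> n) x = p n x" for n x
    unfolding \<mu>_def by (rule pmf_embed_pmf) (simp_all add: p_def total[unfolded p_def])
  have le: "pmf (\<mu> (Suc n)) y \<le> pmf (bind_pmf (\<mu> n) P) y" for n y
  proof (cases "y \<in> S")
    case True
    have "ennreal (p (Suc n) y) = emeasure M (\<Union>x\<in>S. {\<omega> \<in> space M. X n \<omega> = x \<and> X (Suc n) \<omega> = y})"
      unfolding p using XS by (intro arg_cong[where f = "emeasure M"]) auto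
    also have "\<dots> = (\<integral>\<^sup>+x. emeasure M {\<omega> \<in> space M. X n \<omega> = x \<and> X (Suc n) \<omega> = y} \<partial>count_space S)"
    proof (rule emeasure_UN_countable)
      fix x
      have "{\<omega> \<in> space M. X n \<omega> = x \<and> X (Suc n) \<omega> = y}
          = {\<omega> \<in> space M. X n \<omega> = x} \<inter> {\<omega> \<in> space M. X (Suc n) \<omega> = y}" by auto
      then show "{\<omega> \<in> space M. X n \<omega> = x \<and> X (Suc n) \<omega> = y} \<in> sets M" using single by simp
    qed (auto simp: S disjoint_family_on_def)
    also have "\<dots> = (\<integral>\<^sup>+x. ennreal (p n x) * ennreal (pmf (P x) y) \<partial>count_space S)"
      using True by (intro nn_integral_cong) (simp add: markov_chain_joint_prob[OF mc S] p)
    also have "\<dots> = (\<integral>\<^sup>+x. ennreal (p n x) * ennreal (pmf (P x) y) \<partial>count_space UNIV)"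
      by (rule nn_integral_count_space_eq) (simp_all add: p_def out)
    also have "\<dots> = ennreal (pmf (bind_pmf (\<mu> n) P) y)"
      by (simp add: ennreal_pmf_bind nn_integral_measure_pmf \<mu>)
    finally show ?thesis by (simp only: \<mu> ennreal_inj[OF measure_nonneg pmf_nonneg] p_def order_refl)
  qed (simp add: \<mu> p_def out)
  show thesis
  proof (rule that[of \<mu>])
    show "set_pmf (\<mu> n) \<subseteq> S" for n by (auto simp: set_pmf_iff \<mu> p_def) (metis out measure_empty)
  qed (use le in \<open>simp_all add: \<mu> p\<close>)
qed

text \<open>Telescoping the expected drops bounds every partial sum of the visit probabilities by
  the initial expectation divided by \<epsilon>. With values in \<open>ennreal\<close>, no
  integrability has to be checked.\<close>

lemma summable_visits_of_superharmonic:
  fixes f :: "'s \<Rightarrow> ennreal"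
  assumes mc: "markov_chain S P M X" and S: "countable S"
    and bnd: "\<And>x. f x \<le> ennreal C" and \<epsilon>: "\<epsilon> > 0"
    and sup: "\<And>x. x \<in> S \<Longrightarrow> (\<integral>\<^sup>+y. f y \<partial>P x) + ennreal \<epsilon> * indicator {z} x \<le> f x"
  shows "summable (\<lambda>n. measure M {\<omega> \<in> space M. X n \<omega> = z})"
proof -
  obtain \<mu> where \<mu>: "\<And>n x. ennreal (pmf (\<mu> n) x) = emeasure M {\<omega> \<in> space M. X n \<omega> = x}"
    "\<And>n. set_pmf (\<mu> n) \<subseteq> S" "\<And>n y. pmf (\<mu> (Suc n)) y \<le> pmf (bind_pmf (\<mu> n) P) y"
    using markov_chain_laws[OF mc S] by blast
  define a where "a n = (\<integral>\<^sup>+x. f x \<partial>\<mu> n)" for n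
  have step: "a (Suc n) + ennreal (\<epsilon> * pmf (\<mu> n) z) \<le> a n" for n
  proof -
    \<comment> \<open>As \<open>f\<close> is nonnegative, the one-sided comparison of laws is
      enough.\<close>
    have "a (Suc n) \<le> (\<integral>\<^sup>+x. f x \<partial>bind_pmf (\<mu> n) P)"
      unfolding a_def nn_integral_measure_pmf
      by (intro nn_integral_mono mult_right_mono) (simp_all add: \<mu>(3))
    moreover have "ennreal (\<epsilon> * pmf (\<mu> n) z) = (\<integral>\<^sup>+x. ennreal \<epsilon> * indicator {z} x \<partial>\<mu> n)"
      using \<epsilon> by (simp add: nn_integral_cmult ennreal_mult emeasure_pmf_single)
    ultimately have "a (Suc n) + ennreal (\<epsilon> * pmf (\<mu> n) z)
        \<le> (\<integral>\<^sup>+x. (\<integral>\<^sup>+y. f y \<partial>P x) + ennreal \<epsilon> * indicator {z} x \<partial>\<mu> n)"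
      by (simp add: nn_integral_add add_right_mono)
    \<comment> \<open>Superharmonicity is assumed on \<open>S\<close> only, which carries all the
      mass of \<open>\<mu> n\<close>.\<close>
    also have "\<dots> \<le> a n"
      unfolding a_def using \<mu>(2) by (intro nn_integral_mono_AE) (auto simp: AE_measure_pmf_iff intro!: sup)
    finally show ?thesis .
  qed
  have "a 0 \<le> (\<integral>\<^sup>+x. ennreal C \<partial>\<mu> 0)" unfolding a_def by (intro nn_integral_mono bnd)
  then have a0: "a 0 \<le> ennreal C" by (simp add: measure_pmf.emeasure_space_1)
  have sum: "a n + ennreal (\<Sum>k<n. \<epsilon> * pmf (\<mu> k) z) \<le> ennreal C" for n
  proof (induction n)
    case (Suc n)
    have "a (Suc n) + ennreal (\<Sum>k<Suc n. \<epsilon> * pmf (\<mu> k) z)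
        = (a (Suc n) + ennreal (\<epsilon> * pmf (\<mu> n) z)) + ennreal (\<Sum>k<n. \<epsilon> * pmf (\<mu> k) z)"
      using \<epsilon> by (simp add: sum_nonneg ac_simps)
    also have "\<dots> \<le> a n + ennreal (\<Sum>k<n. \<epsilon> * pmf (\<mu> k) z)"
      by (rule add_right_mono[OF step])
    finally show ?case using Suc by order
  qed (simp add: a0)
  \<comment> \<open>\<open>ennreal\<close> maps negative reals to 0, hence \<open>max 0 C\<close>
    when passing back to real numbers.\<close>
  have "(\<Sum>k<n. pmf (\<mu> k) z) \<le> max 0 C / \<epsilon>" for n
  proof -
    have "ennreal (\<Sum>k<n. \<epsilon> * pmf (\<mu> k) z) \<le> a n + ennreal (\<Sum>k<n. \<epsilon> * pmf (\<mu> k) z)"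
      by (rule add_increasing) simp_all
    also have "\<dots> \<le> ennreal (max 0 C)" using order_trans[OF sum[of n] ennreal_leI[of C "max 0 C"]] by simp
    finally have "(\<Sum>k<n. \<epsilon> * pmf (\<mu> k) z) \<le> max 0 C" by (subst (asm) ennreal_le_iff) simp_all
    then show ?thesis using \<epsilon> by (simp add: sum_distrib_left[symmetric] field_simps)
  qed
  then have "summable (\<lambda>n. pmf (\<mu> n) z)" by (intro summableI_nonneg_bounded) simp_all
  moreover have "pmf (\<mu> n) z = measure M {\<omega> \<in> space M. X n \<omega> = z}" for n
    using \<mu>(1)[of n z] by (metis measure_def enn2real_ennreal pmf_nonneg)
  ultimately show ?thesis by simp
qed

text \<open>A visit to \<open>x\<close> is followed by one to \<open>y\<close> with a fixed positive
  probability. Up to that factor, the series for \<open>x\<close> is dominated by the series for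
  \<open>y\<close> shifted by one step.\<close>

lemma summable_visits_predecessor:
  assumes mc: "markov_chain S P M X" and S: "countable S" and xy: "x \<in> S" "y \<in> S"
    and pos: "y \<in> set_pmf (P x)"
    and sum: "summable (\<lambda>n. measure M {\<omega> \<in> space M. X n \<omega> = y})"
  shows "summable (\<lambda>n. measure M {\<omega> \<in> space M. X n \<omega> = x})"
proof -
  interpret prob_space M using mc by (simp add: markov_chain_def)
  note single = sets_markov_chain_visit[OF mc]
  let ?p = "pmf (P x) y"
  have p: "?p > 0" using pos by (simp add: pmf_positive)
  have le: "prob {\<omega> \<in> space M. X n \<omega> = x} * ?p \<le> prob {\<omega> \<in> space M. X (Suc n) \<omega> = y}" for n
  proof -
    have "ennreal (prob {\<omega> \<in> space M. X n \<omega> = x} * ?p)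
        = emeasure M {\<omega> \<in> space M. X n \<omega> = x \<and> X (Suc n) \<omega> = y}"
      unfolding markov_chain_joint_prob[OF mc S xy] by (simp add: emeasure_eq_measure ennreal_mult)
    also have "\<dots> \<le> emeasure M {\<omega> \<in> space M. X (Suc n) \<omega> = y}"
      by (intro emeasure_mono single) auto
    finally show ?thesis by (simp add: emeasure_eq_measure)
  qed
  have "summable (\<lambda>n. prob {\<omega> \<in> space M. X (Suc n) \<omega> = y})"
    using sum by (rule summable_ignore_initial_segment[of _ 1, simplified])
  then have "summable (\<lambda>n. prob {\<omega> \<in> space M. X n \<omega> = x} * ?p)"
    by (rule summable_comparison_test'[where N = 0]) (simp add: le)
  then have "summable (\<lambda>n. prob {\<omega> \<in> space M. X n \<omega> = x} * ?p / ?p)"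
    by (rule summable_divide)
  then show ?thesis using p by simp
qed

text \<open>Borel-Cantelli gives a null set for each state. Countability of \<open>S\<close> allows
  one null set for all states, and a finite set is left for good once each of its points is.\<close>

lemma transientI_summable_visits:
  assumes mc: "markov_chain S P M X" and S: "countable S"
    and sum: "\<And>x. x \<in> S \<Longrightarrow> summable (\<lambda>n. measure M {\<omega> \<in> space M. X n \<omega> = x})"
  shows "transient S M X"
proof -
  interpret prob_space M using mc by (simp add: markov_chain_def)
  have "AE \<omega> in M. \<forall>x\<in>S. eventually (\<lambda>n. X n \<omega> \<noteq> x) sequentially"
  proof (subst AE_ball_countable[OF S], rule ballI)
    fix x assume x: "x \<in> S"
    note single = sets_markov_chain_visit[OF mc]
    have "AE \<omega> in M. eventually (\<lambda>n. \<omega> \<in> space M - {\<omega> \<in> space M. X n \<omega> = x}) sequentially"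
      by (rule borel_cantelli_AE1) (auto simp: single sum x emeasure_eq_measure)
    then show "AE \<omega> in M. eventually (\<lambda>n. X n \<omega> \<noteq> x) sequentially"
      by eventually_elim (auto elim: eventually_mono)
  qed
  then show ?thesis unfolding transient_def
  proof eventually_elim
    case (elim \<omega>)
    show ?case
    proof (intro allI impI)
      fix T assume T: "finite T" "T \<subseteq> S"
      then have "eventually (\<lambda>n. \<forall>x\<in>T. X n \<omega> \<noteq> x) sequentially"
        using elim by (intro eventually_ball_finite) auto
      then show "\<exists>N. \<forall>n\<ge>N. X n \<omega> \<notin> T" unfolding eventually_sequentially by blast
    qed
  qed
qed

section \<open>Dyadic levels and the superharmonic function on \<Gamma>\<close>

text \<open>For dyadic \<open>x\<close> this is the exponent of 2 in the reduced denominator. For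
  other reals no such \<open>n\<close> exists and the value is unspecified, which is why the rules
  for doubling and halving assume dyadicity.\<close>

definition dyadic_level :: "real \<Rightarrow> nat" where
  "dyadic_level x = (LEAST n. x * 2 ^ n \<in> \<int>)"

text \<open>Removing the integers and the half-lines hanging off \<open>(0, 1)\<close> and \<open>(1, 2)\<close>
  leaves a binary tree rooted at \<open>1 / 2\<close>, in which \<open>x \<in> (0, 1)\<close> has the children
  \<open>x / 2\<close> and, through the intermediate vertex \<open>x + 1\<close>, \<open>(x + 1) / 2\<close>.
  With ratio \<open>2 / 3\<close> per level, the factor \<open>5 / 6 = (1 + 2 / 3) / 2\<close> is the one that makes
  the potential harmonic at the intermediate vertices.\<close>

definition potential :: "real \<Rightarrow> real" where
  "potential x = (if x \<in> \<int> then 1 else if x < 1 then (2/3) ^ dyadic_level x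
     else 5/6 * (2/3) ^ dyadic_level x)"

lemma dyadic_rationals_iff: "x \<in> dyadic_rationals \<longleftrightarrow> (\<exists>n. x * 2 ^ n \<in> \<int>)"
proof
  assume "\<exists>n. x * 2 ^ n \<in> \<int>"
  then obtain n m where "x * 2 ^ n = of_int m" by (auto elim: Ints_cases)
  then have "x = of_int m / 2 ^ n" by (simp add: field_simps)
  then show "x \<in> dyadic_rationals" by (auto simp: dyadic_rationals_def)
next
  assume "x \<in> dyadic_rationals"
  then obtain m n where "x = of_int m / 2 ^ n" by (auto simp: dyadic_rationals_def)
  then have "x * 2 ^ n \<in> \<int>" by simp
  then show "\<exists>n. x * 2 ^ n \<in> \<int>" ..
qed

lemma Ints_add_iff [simp]:
  fixes x :: "'a::ring_1"
  assumes "k \<in> \<int>"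
  shows "x + k \<in> \<int> \<longleftrightarrow> x \<in> \<int>"
  using Ints_diff[of "x + k" k] assms by auto

lemma Ints_diff_iff [simp]:
  fixes x :: "'a::ring_1"
  assumes "k \<in> \<int>"
  shows "x - k \<in> \<int> \<longleftrightarrow> x \<in> \<int>"
  using Ints_add[of "x - k" k] assms by auto

lemma dyadic_level_add: "k \<in> \<int> \<Longrightarrow> dyadic_level (x + k) = dyadic_level x"
  by (simp add: dyadic_level_def distrib_right)

lemma dyadic_level_diff: "k \<in> \<int> \<Longrightarrow> dyadic_level (x - k) = dyadic_level x"
  by (simp add: dyadic_level_def left_diff_distrib)

lemma dyadic_level_Int: "x \<in> \<int> \<Longrightarrow> dyadic_level x = 0"
  by (simp add: dyadic_level_def)

lemma dyadic_level_double:
  assumes "x \<in> dyadic_rationals" "x \<notin> \<int>"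
  shows "dyadic_level x = Suc (dyadic_level (2 * x))"
proof -
  obtain n where "x * 2 ^ n \<in> \<int>" using assms by (auto simp: dyadic_rationals_iff)
  then show ?thesis
    unfolding dyadic_level_def using assms(2) by (subst Least_Suc[of _ n]) (auto simp: ac_simps)
qed

lemma dyadic_half:
  assumes "x \<in> dyadic_rationals"
  shows "x / 2 \<in> dyadic_rationals"
proof -
  obtain n where "x * 2 ^ n \<in> \<int>" using assms by (auto simp: dyadic_rationals_iff)
  then have "x / 2 * 2 ^ Suc n \<in> \<int>" by simp
  then show ?thesis unfolding dyadic_rationals_iff by blast
qed

lemma half_not_Int: "(x::real) \<notin> \<int> \<Longrightarrow> x / 2 \<notin> \<int>"
  using Ints_mult[of 2 "x / 2"] by auto

lemma dyadic_level_half: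
  assumes "x \<in> dyadic_rationals" "x \<notin> \<int>"
  shows "dyadic_level (x / 2) = Suc (dyadic_level x)"
  using dyadic_level_double[of "x / 2"] assms by (simp add: dyadic_half half_not_Int)

text \<open>Write \<open>r\<close> for the ratio per level and c = (1 + r)/2 for the factor at
  intermediate vertices. On (0, 1), relative to the value at \<open>x\<close>, the four neighbours
  contribute at most 1 + c + r + 1/r. This equals 4 exactly when 3 r^2 - 5 r + 2 = 0, whose root
  below 1 is r = 2/3. On (1, 2) the choice of \<open>c\<close> gives 1 + 2 c + r = 4 c. On the
  negative and beyond-2 half-lines all four neighbours of a non-integer have its own
  potential.\<close>

lemma potential_superharmonic:
  assumes x: "x \<in> dyadic_rationals"
  shows "potential (A_tilde x) + potential (inv A_tilde x) + potential (B_tilde x)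
    + potential (inv B_tilde x) + 1/3 * indicator {1} x \<le> 4 * potential x"
proof (cases "x \<in> \<int>")
  case True
  show ?thesis
  proof (cases "x = 1")
    case x1: True
    \<comment> \<open>The neighbours of 1 are 0, 2, 2 with potential 1 and 1/2 with potential 2/3.
      Their sum 11/3 falls short of 4 by the 1/3 in the statement.\<close>
    have "(1/2 :: real) \<notin> \<int>"
    proof
      assume "(1/2 :: real) \<in> \<int>"
      then obtain k :: int where "1/2 = (of_int k :: real)" by (elim Ints_cases)
      then have "of_int (2 * k) = (of_int 1 :: real)" by simp
      then have "2 * k = 1" by (simp only: of_int_eq_iff)
      then show False by presburger
    qed
    moreover have "dyadic_level (1/2) = 1"
      using calculation dyadic_level_double[of "1/2"] x x1 dyadic_half[of 1] by (simp add: dyadic_level_Int)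
    ultimately have "potential (1/2) = 2/3" by (simp add: potential_def)
    then show ?thesis
      by (simp add: x1 A_tilde_def inv_A_tilde B_tilde_def inv_B_tilde potential_def)
  next
    case False
    obtain k :: int where k: "x = of_int k" using True by (elim Ints_cases)
    \<comment> \<open>Among the integers, only 1 has a non-integral neighbour, so the potential is
      constantly 1 around the others.\<close>
    have "B_tilde x \<in> \<int>" "inv B_tilde x \<in> \<int>"
    proof -
      have "k \<le> 0 \<or> k \<ge> 2" using False k by (cases "k = 1") auto
      then have "x \<le> 0 \<or> x \<ge> 2" unfolding k by simp
      then show "B_tilde x \<in> \<int>" "inv B_tilde x \<in> \<int>"
        using True by (auto simp: B_tilde_def inv_B_tilde)
    qed
    then show ?thesis using True False by (simp add: potential_def A_tilde_def inv_A_tilde)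
  qed
next
  case False
  let ?t = "(2/3 :: real) ^ dyadic_level x"
  have t: "?t > 0" by simp
  have up: "potential (x + 1) = (if x < 0 then ?t else 5/6 * ?t)"
    using False by (simp add: potential_def dyadic_level_add)
  have down: "potential (x - 1) = (if x < 2 then ?t else 5/6 * ?t)"
    using False by (simp add: potential_def dyadic_level_diff)
  have self: "potential x = (if x < 1 then ?t else 5/6 * ?t)"
    using False by (simp add: potential_def)
  have half: "potential (x / 2) = 2/3 * ?t" if "x < 2"
    using that False by (simp add: potential_def half_not_Int dyadic_level_half x)
  \<comment> \<open>Equality holds if \<open>2 * x\<close> is below 1 or an integer: in the latter
    case \<open>x\<close> has level 1 and 3/2 * 2/3 = 1. Otherwise the factor 5/6 only lowers the
    left side.\<close>
  have double: "potential (2 * x) \<le> 3/2 * ?t"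
    using dyadic_level_double[OF x False] by (simp add: potential_def dyadic_level_Int)
  have ne: "x \<noteq> 0" "x \<noteq> 1" "x \<noteq> 2" using False by auto
  then consider "x < 0" | "0 < x" "x < 1" | "1 < x" "x < 2" | "2 < x" by linarith
  then show ?thesis
    using up down self half double ne t
    by cases (simp_all add: A_tilde_def inv_A_tilde B_tilde_def inv_B_tilde)
qed

section \<open>Reaching 1 from every vertex of \<Gamma>\<close>

text \<open>The induction runs backwards along arcs, matching the passage of summability to
  predecessors. \<open>A_tilde\<close> and its inverse make \<open>Q\<close> invariant under integer
  translations, which settles the integers. Any other \<open>x\<close> is translated into (0, 1),
  where \<open>inv B_tilde\<close> is doubling and lowers the level.\<close>

lemma dyadic_induct:
  assumes x: "x \<in> dyadic_rationals" and one: "Q 1"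
    and pre: "\<And>x g. x \<in> dyadic_rationals \<Longrightarrow> g \<in> gens \<Longrightarrow> Q (g x) \<Longrightarrow> Q x"
  shows "Q x"
proof -
  have D: "y + of_int k \<in> dyadic_rationals" if "y \<in> dyadic_rationals" for y k
    using that by (auto simp: dyadic_rationals_iff distrib_right)
  have shift: "Q (y + of_int k)" if y: "y \<in> dyadic_rationals" "Q y" for y k
  proof (induction k rule: int_induct[where k = 0])
    case (step1 i)
    then show ?case
      using pre[of "y + of_int (i + 1)" A_tilde] D[OF y(1), of "i + 1"]
      by (simp add: gens_def A_tilde_def algebra_simps)
  next
    case (step2 i)
    then show ?case
      using pre[of "y + of_int (i - 1)" "inv A_tilde"] D[OF y(1), of "i - 1"]
      by (simp add: gens_def inv_A_tilde algebra_simps)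
  qed (simp add: y)
  have "1 * 2 ^ 0 \<in> (\<int> :: real set)" by simp
  then have 1: "1 \<in> dyadic_rationals" unfolding dyadic_rationals_iff by blast
  show ?thesis using x
  proof (induction "dyadic_level x" arbitrary: x rule: less_induct)
    case less
    show ?case
    proof (cases "x \<in> \<int>")
      case True
      then obtain k where "x = of_int k" by (elim Ints_cases)
      then show ?thesis using shift[OF 1 one, of "k - 1"] by simp
    next
      case False
      have y: "frac x \<in> dyadic_rationals"
        using D[OF less.prems, of "- \<lfloor>x\<rfloor>"] by (simp add: frac_def)
      have nI: "frac x \<notin> \<int>" using False by (simp add: frac_def)
      have "dyadic_level (frac x) = dyadic_level x" by (simp add: frac_def dyadic_level_diff)
      then have "dyadic_level (2 * frac x) < dyadic_level x"
        using dyadic_level_double[OF y nI] by simp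
      moreover have "2 * frac x \<in> dyadic_rationals"
      proof -
        obtain n where "frac x * 2 ^ n \<in> \<int>" using y by (auto simp: dyadic_rationals_iff)
        then have "2 * (frac x * 2 ^ n) \<in> \<int>" by (rule Ints_mult[OF Ints_numeral])
        then show ?thesis unfolding dyadic_rationals_iff by (metis mult.assoc)
      qed
      ultimately have "Q (2 * frac x)" using less.hyps by blast
      moreover have "inv B_tilde (frac x) = 2 * frac x"
        using False frac_lt_1[of x] by (simp add: inv_B_tilde not_le frac_gt_0_iff)
      ultimately have "Q (frac x)" using pre[OF y, of "inv B_tilde"] by (simp add: gens_def)
      then show ?thesis using shift[OF y, of "\<lfloor>x\<rfloor>"] by (simp add: frac_def)
    qed
  qed
qed

section \<open>Transience of the walk on \<Gamma>\<close>

lemma countable_dyadic_rationals: "countable dyadic_rationals"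
proof -
  have "dyadic_rationals = (\<lambda>(m::int, n::nat). of_int m / 2 ^ n) ` UNIV"
    by (auto simp: dyadic_rationals_def)
  then show ?thesis by (metis countable_image countableI_type)
qed

text \<open>The average is taken over arcs rather than targets, so coinciding targets are counted
  with multiplicity. The divisor is 4 everywhere because the four generators are distinct as maps,
  even where their values agree.\<close>

lemma nn_integral_srw_step_Gamma:
  assumes x: "x \<in> dyadic_rationals" and f: "\<And>y. f y \<ge> 0"
  shows "(\<integral>\<^sup>+y. ennreal (f y) \<partial>srw_step \<Gamma> x)
    = ennreal ((f (A_tilde x) + f (inv A_tilde x) + f (B_tilde x) + f (inv B_tilde x)) / 4)"
proof -
  have oa: "out_arcs \<Gamma> x = Pair x ` gens"
    using x by (auto simp: out_arcs_def \<Gamma>_def schreier_graph_def)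
  have head: "head \<Gamma> (x, g) = g x" for g by (simp add: \<Gamma>_def schreier_graph_def)
  have inj: "inj_on (Pair x) gens" by (simp add: inj_on_def)
  have fin: "finite (out_arcs \<Gamma> x)" "out_arcs \<Gamma> x \<noteq> {}" by (simp_all add: oa gens_def)
  have card: "card (out_arcs \<Gamma> x) = 4"
    unfolding oa using gens_distinct by (simp add: card_image[OF inj]) (simp add: gens_def)
  have "(\<integral>\<^sup>+y. ennreal (f y) \<partial>srw_step \<Gamma> x) = (\<Sum>e\<in>out_arcs \<Gamma> x. ennreal (f (head \<Gamma> e))) / 4"
    by (simp add: srw_step_def nn_integral_pmf_of_set[OF fin(2,1)] card)
  also have "\<dots> = ennreal ((\<Sum>g\<in>gens. f (g x)) / 4)"
    by (simp add: oa sum.reindex[OF inj] head f sum_nonneg flip: divide_ennreal)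
  also have "(\<Sum>g\<in>gens. f (g x))
      = f (A_tilde x) + f (inv A_tilde x) + f (B_tilde x) + f (inv B_tilde x)"
    using gens_distinct by (auto simp: gens_def)
  finally show ?thesis .
qed

theorem theorem14:
  fixes M :: "'w measure" and X :: "nat \<Rightarrow> 'w \<Rightarrow> real"
  assumes "simple_random_walk \<Gamma> M X"
  shows "transient (verts \<Gamma>) M X"
proof -
  have V: "verts \<Gamma> = dyadic_rationals" by (simp add: \<Gamma>_def schreier_graph_def)
  have mc: "markov_chain dyadic_rationals (srw_step \<Gamma>) M X"
    using assms by (simp add: simple_random_walk_def V)
  have pos: "potential x \<ge> 0" for x by (simp add: potential_def)
  have le1: "potential x \<le> 1" for x
  proof -
    have "(2/3 :: real) ^ dyadic_level x \<le> 1" by (rule power_le_one) simp_all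
    then show ?thesis by (simp add: potential_def)
  qed
  have closed: "g x \<in> dyadic_rationals" if "x \<in> dyadic_rationals" "g \<in> gens" for x g
    using wf_digraph.head_in_verts[OF wf_Gamma, of "(x, g)"] that
    by (simp add: \<Gamma>_def schreier_graph_def)
  have "summable (\<lambda>n. measure M {\<omega> \<in> space M. X n \<omega> = 1})"
  proof (rule summable_visits_of_superharmonic[OF mc countable_dyadic_rationals])
    show "ennreal (potential x) \<le> ennreal 1" for x using le1 by (rule ennreal_leI)
    \<comment> \<open>The gap 1/3 in the sum over four neighbours becomes 1/12 in their
      average.\<close>
    show "(1/12 :: real) > 0" by simp
    fix x assume x: "x \<in> dyadic_rationals"
    have scale: "u / 4 + 1/12 * i \<le> p" if "u + 1/3 * i \<le> 4 * p" for u i p :: real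
      using that by linarith
    have "(\<integral>\<^sup>+y. ennreal (potential y) \<partial>srw_step \<Gamma> x) + ennreal (1/12) * indicator {1} x
      = ennreal ((potential (A_tilde x) + potential (inv A_tilde x) + potential (B_tilde x)
          + potential (inv B_tilde x)) / 4 + 1/12 * indicator {1} x)"
      unfolding nn_integral_srw_step_Gamma[of x potential, OF x pos]
      by (auto simp: pos ennreal_plus split: split_indicator)
    also have "\<dots> \<le> ennreal (potential x)"
      by (intro ennreal_leI scale potential_superharmonic x)
    finally show "(\<integral>\<^sup>+y. ennreal (potential y) \<partial>srw_step \<Gamma> x) + ennreal (1/12) * indicator {1} x
      \<le> ennreal (potential x)" .
  qed
  \<comment> \<open>This is the induction step for \<open>dyadic_induct\<close>: every generator is
    chosen with positive probability.\<close>
  moreover have "summable (\<lambda>n. measure M {\<omega> \<in> space M. X n \<omega> = x})"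
    if "x \<in> dyadic_rationals" "g \<in> gens" "summable (\<lambda>n. measure M {\<omega> \<in> space M. X n \<omega> = g x})" for x g
  proof (rule summable_visits_predecessor[OF mc countable_dyadic_rationals])
    show "g x \<in> set_pmf (srw_step \<Gamma> x)" using that by (auto simp: srw_step_Gamma gens_def)
  qed (use that closed in auto)
  ultimately have "summable (\<lambda>n. measure M {\<omega> \<in> space M. X n \<omega> = x})"
    if "x \<in> dyadic_rationals" for x
    by (rule dyadic_induct[where Q = "\<lambda>x. summable (\<lambda>n. measure M {\<omega> \<in> space M. X n \<omega> = x})", OF that])
  then show ?thesis
    unfolding V by (rule transientI_summable_visits[OF mc countable_dyadic_rationals])
qed

end
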